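(* Let $\eta\ge0$. Suppose $\mu_1$ satisfies the weighted Poincaré inequality $$\mathrm{Var}_{\mu_1}(f)\le C_1\int U^{-2\eta}|\nabla f|^2d\mu_1\quad\text{for all smooth }f\text{ on }\mathbb R^d.$$ Then for all smooth $h$ on $\mathbb R^{2d}$, $$\mathrm{Var}_\mu(h)\le C'\int\big(H^{-2\eta}|\nabla_xh|^2+|\nabla_yh|^2\big)d\mu,\qquad C'\le\max\Big(2+\frac4{M_2},\ \frac{4C_1}{M_2}\Big),$$ where $M_2=\int(1+\frac12|y|^2)^{-2\eta}\mu_2(dy)$.
   Context: $U:\mathbb R^d\to\mathbb R$ smooth, $U\ge1$, $\int e^{-U}dx<\infty$, $H(x,y)=U(x)+\frac12|y|^2$, $\mu=Z^{-1}e^{-H}dxdy$ on $\mathbb R^{2d}$. Then $\mu=\mu_1\otimes\mu_2$ where $\mu_1(dx)=Z_1^{-1}e^{-U(x)}dx$ and $\mu_2$ is the standard Gaussian measure on $\mathbb R^d$. $\mathrm{Var}_\nu(g)=\int g^2d\nu-(\int gd\nu)^2$. *)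

theory Defs
  imports "HOL-Analysis.Analysis"
begin

text \<open>Smooth (C-infinity) real functions on a Euclidean space: differentiable everywhere,
  and every partial derivative along a basis vector is again smooth (greatest fixed point,
  i.e. partial derivatives of all orders exist).\<close>
coinductive smooth :: "('a::euclidean_space \<Rightarrow> real) \<Rightarrow> bool" where
  "(\<forall>x. f differentiable (at x)) \<Longrightarrow>
   (\<forall>b\<in>Basis. smooth (\<lambda>x. frechet_derivative f (at x) b)) \<Longrightarrow> smooth f"

definition Var :: "'b measure \<Rightarrow> ('b \<Rightarrow> real) \<Rightarrow> ereal" where
  "Var \<nu> g = (if integrable \<nu> (\<lambda>x. (g x)\<^sup>2)
     then ereal ((\<integral>x. (g x)\<^sup>2 \<partial>\<nu>) - (\<integral>x. g x \<partial>\<nu>)\<^sup>2) else \<infinity>)"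

definition grad_sq :: "('a::euclidean_space \<Rightarrow> real) \<Rightarrow> 'a \<Rightarrow> real" where
  "grad_sq f x = (\<Sum>b\<in>Basis. (frechet_derivative f (at x) b)\<^sup>2)"

definition grad_x_sq :: "('a::euclidean_space \<times> 'a \<Rightarrow> real) \<Rightarrow> 'a \<times> 'a \<Rightarrow> real" where
  "grad_x_sq h p = (\<Sum>b\<in>Basis. (frechet_derivative h (at p) (b, 0))\<^sup>2)"

definition grad_y_sq :: "('a::euclidean_space \<times> 'a \<Rightarrow> real) \<Rightarrow> 'a \<times> 'a \<Rightarrow> real" where
  "grad_y_sq h p = (\<Sum>b\<in>Basis. (frechet_derivative h (at p) (0, b))\<^sup>2)"

definition Hfun :: "('a::euclidean_space \<Rightarrow> real) \<Rightarrow> 'a \<times> 'a \<Rightarrow> real" where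
  "Hfun U p = U (fst p) + (norm (snd p))\<^sup>2 / 2"

definition mu1 :: "('a::euclidean_space \<Rightarrow> real) \<Rightarrow> 'a measure" where
  "mu1 U = density lborel (\<lambda>x. ennreal (exp (- U x) / (\<integral>z. exp (- U z) \<partial>lborel)))"

definition mu2 :: "'a::euclidean_space measure" where
  "mu2 = density lborel (\<lambda>y. ennreal ((2 * pi) powr (- real DIM('a) / 2) * exp (- (norm y)\<^sup>2 / 2)))"

definition mu :: "('a::euclidean_space \<Rightarrow> real) \<Rightarrow> ('a \<times> 'a) measure" where
  "mu U = density lborel (\<lambda>p. ennreal (exp (- Hfun U p) / (\<integral>q. exp (- Hfun U q) \<partial>lborel)))"

end

theory Submission
  imports Defs "HOL-Probability.Distributions"
begin

text \<open>
  Moving from \<open>y\<close> to \<open>z\<close> along the circular arc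
  \<open>cos t \<cdot> y + sin t \<cdot> z\<close>, \<open>0 \<le> t \<le> \<pi>/2\<close>, and using the rotation invariance of
  \<open>\<mu>\<^sub>2 \<otimes> \<mu>\<^sub>2\<close>, one gets \<open>\<integral>\<integral> (f y - f z)\<^sup>2 d\<mu>\<^sub>2 d\<mu>\<^sub>2 \<le> (\<pi>\<^sup>2/4) \<integral> |\<nabla>f|\<^sup>2 d\<mu>\<^sub>2\<close>;
  this Gaussian Poincare inequality is not sharp, but suffices here.
  For fixed \<open>z\<close> and any \<open>c\<close>,
  \<open>(h(x,y) - c)\<^sup>2 \<le> 4/3 (h(x,y) - h(x,z))\<^sup>2 + 4 (h(x,z) - c)\<^sup>2\<close>.
  Average this over \<open>z\<close> with the weight \<open>w(z) = (1 + |z|\<^sup>2/2)\<^sup>-\<^sup>2\<^sup>\<eta> \<le> 1\<close>, whose total mass is \<open>M\<^sub>2\<close>.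
  The first term is controlled by the Gaussian inequality, since \<open>4/3 \<cdot> \<pi>\<^sup>2/4 \<le> 4\<close>; the second by
  the weighted inequality for \<open>h(\<cdot>,z)\<close>, since \<open>H(x,z) \<le> U(x) (1 + |z|\<^sup>2/2)\<close> because \<open>U \<ge> 1\<close>.
  Hence some \<open>z\<close> is no worse than the average, and the mean \<open>c\<close> of \<open>h(\<cdot>,z)\<close> satisfies
  \<open>\<integral> (h - c)\<^sup>2 d\<mu> \<le> C' \<integral> (H\<^sup>-\<^sup>2\<^sup>\<eta> |\<nabla>\<^sub>x h|\<^sup>2 + |\<nabla>\<^sub>y h|\<^sup>2) d\<mu>\<close>.
\<close>

section \<open>Smooth functions\<close>

text \<open>Collecting the partial derivatives in one vector turns the derivative along a curve into
  an inner product, the form to which the Gaussian second moment identity applies.\<close>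

definition gradient :: "('a::euclidean_space \<Rightarrow> real) \<Rightarrow> 'a \<Rightarrow> 'a" where
  "gradient f x = (\<Sum>b\<in>Basis. frechet_derivative f (at x) b *\<^sub>R b)"

lemma smooth_differentiable: "smooth f \<Longrightarrow> f differentiable (at x)"
  by (erule smooth.cases) auto

lemma smooth_partial: "smooth f \<Longrightarrow> b \<in> Basis \<Longrightarrow> smooth (\<lambda>x. frechet_derivative f (at x) b)"
  by (erule smooth.cases) auto

lemma smooth_continuous_on: "smooth f \<Longrightarrow> continuous_on A f"
  by (meson smooth_differentiable differentiable_imp_continuous_on differentiable_on_def
      differentiable_at_withinI)

lemma smooth_borel_measurable: "smooth f \<Longrightarrow> f \<in> borel_measurable borel"
  by (intro borel_measurable_continuous_onI smooth_continuous_on)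

lemma continuous_on_gradient: "smooth f \<Longrightarrow> continuous_on A (gradient f)"
  unfolding gradient_def by (intro continuous_intros smooth_continuous_on smooth_partial)

lemma gradient_borel_measurable: "smooth f \<Longrightarrow> gradient f \<in> borel_measurable borel"
  by (intro borel_measurable_continuous_onI continuous_on_gradient)

lemma frechet_derivative_eq_gradient:
  assumes "f differentiable (at x)"
  shows "frechet_derivative f (at x) v = gradient f x \<bullet> v"
proof -
  interpret D: linear "frechet_derivative f (at x)"
    using assms by (rule linear_frechet_derivative)
  have "frechet_derivative f (at x) v = frechet_derivative f (at x) (\<Sum>b\<in>Basis. (v \<bullet> b) *\<^sub>R b)"
    by (simp add: euclidean_representation)
  also have "\<dots> = (\<Sum>b\<in>Basis. (v \<bullet> b) * frechet_derivative f (at x) b)"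
    by (simp add: D.sum D.scaleR)
  finally show ?thesis
    by (simp add: gradient_def inner_sum_left inner_commute[of v] mult.commute)
qed

lemma smooth_has_derivative:
  "smooth f \<Longrightarrow> (f has_derivative (\<lambda>v. gradient f x \<bullet> v)) (at x)"
  by (metis (no_types, lifting) ext frechet_derivative_eq_gradient frechet_derivative_works
      smooth_differentiable)

lemma grad_sq_eq_norm_gradient: "grad_sq f x = (norm (gradient f x))\<^sup>2"
  unfolding power2_norm_eq_inner
  by (simp add: grad_sq_def gradient_def inner_sum_left inner_sum_right inner_Basis
      power2_eq_square if_distrib[of "\<lambda>x. _ * x"] sum.delta cong: if_cong)

section \<open>Restrictions of functions on the product to one of the two variables\<close>

lemma frechet_derivative_slice_fst:
  assumes "h differentiable (at (x, y))"
  shows "frechet_derivative (\<lambda>x. h (x, y)) (at x) b = frechet_derivative h (at (x, y)) (b, 0)"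
    and "(\<lambda>x. h (x, y)) differentiable (at x)"
proof -
  have "((\<lambda>x. h (x, y)) has_derivative (\<lambda>b. frechet_derivative h (at (x, y)) (b, 0))) (at x)"
    by (rule has_derivative_compose[where f="\<lambda>x. (x, y)" and g=h, OF _
          assms[unfolded frechet_derivative_works]]) (auto intro!: derivative_eq_intros)
  then show "frechet_derivative (\<lambda>x. h (x, y)) (at x) b = frechet_derivative h (at (x, y)) (b, 0)"
    and "(\<lambda>x. h (x, y)) differentiable (at x)"
    by (auto simp: differentiable_def dest: frechet_derivative_at[symmetric])
qed

lemma frechet_derivative_slice_snd:
  assumes "h differentiable (at (x, y))"
  shows "frechet_derivative (\<lambda>y. h (x, y)) (at y) b = frechet_derivative h (at (x, y)) (0, b)"
    and "(\<lambda>y. h (x, y)) differentiable (at y)"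
proof -
  have "((\<lambda>y. h (x, y)) has_derivative (\<lambda>b. frechet_derivative h (at (x, y)) (0, b))) (at y)"
    by (rule has_derivative_compose[where f="\<lambda>y. (x, y)" and g=h, OF _
          assms[unfolded frechet_derivative_works]]) (auto intro!: derivative_eq_intros)
  then show "frechet_derivative (\<lambda>y. h (x, y)) (at y) b = frechet_derivative h (at (x, y)) (0, b)"
    and "(\<lambda>y. h (x, y)) differentiable (at y)"
    by (auto simp: differentiable_def dest: frechet_derivative_at[symmetric])
qed

text \<open>By coinduction on the class of all slices at \<open>y\<close> of smooth functions: it is
  closed under partial derivatives, since the \<open>b\<close>-derivative of a slice is the slice of
  the \<open>(b, 0)\<close>-derivative.\<close>

lemma smooth_slice_fst:
  fixes h :: "'a::euclidean_space \<times> 'b::euclidean_space \<Rightarrow> real"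
  assumes "smooth h" shows "smooth (\<lambda>x. h (x, y))"
proof -
  define X where "X = (\<lambda>f::'a \<Rightarrow> real. \<exists>h :: 'a \<times> 'b \<Rightarrow> real. smooth h \<and> f = (\<lambda>x. h (x, y)))"
  have "X (\<lambda>x. h (x, y))" using assms by (auto simp: X_def)
  then show ?thesis
  proof (rule smooth.coinduct)
    fix f assume "X f"
    then obtain h :: "'a \<times> 'b \<Rightarrow> real" where h: "smooth h" "f = (\<lambda>x. h (x, y))"
      by (auto simp: X_def)
    have "X (\<lambda>x. frechet_derivative f (at x) b)" if "b \<in> Basis" for b
      unfolding X_def h(2)
      using smooth_partial[OF h(1), of "(b, 0)"] that
      by (intro exI[of _ "\<lambda>p. frechet_derivative h (at p) (b, 0)"])
         (auto simp: frechet_derivative_slice_fst smooth_differentiable[OF h(1)] Basis_prod_def)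
    then show "\<exists>g. f = g \<and> (\<forall>x. g differentiable at x) \<and>
        (\<forall>b\<in>Basis. X (\<lambda>x. frechet_derivative g (at x) b) \<or> smooth (\<lambda>x. frechet_derivative g (at x) b))"
      using h by (auto simp: frechet_derivative_slice_fst smooth_differentiable)
  qed
qed

lemma smooth_slice_snd:
  fixes h :: "'a::euclidean_space \<times> 'b::euclidean_space \<Rightarrow> real"
  assumes "smooth h" shows "smooth (\<lambda>y. h (x, y))"
proof -
  define X where "X = (\<lambda>f::'b \<Rightarrow> real. \<exists>h :: 'a \<times> 'b \<Rightarrow> real. smooth h \<and> f = (\<lambda>y. h (x, y)))"
  have "X (\<lambda>y. h (x, y))" using assms by (auto simp: X_def)
  then show ?thesis
  proof (rule smooth.coinduct)
    fix f assume "X f"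
    then obtain h :: "'a \<times> 'b \<Rightarrow> real" where h: "smooth h" "f = (\<lambda>y. h (x, y))"
      by (auto simp: X_def)
    have "X (\<lambda>y. frechet_derivative f (at y) b)" if "b \<in> Basis" for b
      unfolding X_def h(2)
      using smooth_partial[OF h(1), of "(0, b)"] that
      by (intro exI[of _ "\<lambda>p. frechet_derivative h (at p) (0, b)"])
         (auto simp: frechet_derivative_slice_snd smooth_differentiable[OF h(1)] Basis_prod_def)
    then show "\<exists>g. f = g \<and> (\<forall>x. g differentiable at x) \<and>
        (\<forall>b\<in>Basis. X (\<lambda>x. frechet_derivative g (at x) b) \<or> smooth (\<lambda>x. frechet_derivative g (at x) b))"
      using h by (auto simp: frechet_derivative_slice_snd smooth_differentiable)
  qed
qed

lemma grad_sq_slice_fst: "smooth h \<Longrightarrow> grad_sq (\<lambda>x. h (x, y)) x = grad_x_sq h (x, y)"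
  by (simp add: grad_sq_def grad_x_sq_def frechet_derivative_slice_fst smooth_differentiable)

lemma grad_sq_slice_snd: "smooth h \<Longrightarrow> grad_sq (\<lambda>y. h (x, y)) y = grad_y_sq h (x, y)"
  by (simp add: grad_sq_def grad_y_sq_def frechet_derivative_slice_snd smooth_differentiable)

lemma grad_x_sq_borel_measurable: "smooth h \<Longrightarrow> grad_x_sq h \<in> borel_measurable borel"
  unfolding grad_x_sq_def
  by (intro borel_measurable_sum borel_measurable_power smooth_borel_measurable smooth_partial)
     (auto simp: Basis_prod_def)

lemma grad_y_sq_borel_measurable: "smooth h \<Longrightarrow> grad_y_sq h \<in> borel_measurable borel"
  unfolding grad_y_sq_def
  by (intro borel_measurable_sum borel_measurable_power smooth_borel_measurable smooth_partial)
     (auto simp: Basis_prod_def)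

section \<open>Rotations and the Gaussian measure\<close>

lemma nn_integral_lborel_shift:
  fixes f :: "'a::euclidean_space \<Rightarrow> ennreal"
  assumes [measurable]: "f \<in> borel_measurable borel"
  shows "(\<integral>\<^sup>+x. f (x + c) \<partial>lborel) = (\<integral>\<^sup>+x. f x \<partial>lborel)"
proof -
  have "(\<integral>\<^sup>+x. f x \<partial>lborel) = (\<integral>\<^sup>+x. f x \<partial>distr lborel borel ((+) c))"
    by (simp add: lborel_distr_plus)
  also have "\<dots> = (\<integral>\<^sup>+x. f (x + c) \<partial>lborel)"
    by (subst nn_integral_distr) (auto simp: add.commute)
  finally show ?thesis by simp
qed

lemma nn_integral_lborel_shear_snd:
  fixes F :: "'a::euclidean_space \<times> 'a \<Rightarrow> ennreal"
  assumes [measurable]: "F \<in> borel_measurable (borel \<Otimes>\<^sub>M borel)"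
  shows "(\<integral>\<^sup>+x. \<integral>\<^sup>+y. F (x, y + t *\<^sub>R x) \<partial>lborel \<partial>lborel) = (\<integral>\<^sup>+x. \<integral>\<^sup>+y. F (x, y) \<partial>lborel \<partial>lborel)"
  by (intro nn_integral_cong nn_integral_lborel_shift) measurable

text \<open>With \<open>y\<close> fixed the shear is a translation in \<open>x\<close>, so Fubini
  first makes \<open>x\<close> the inner variable and then restores the order.\<close>

lemma nn_integral_lborel_shear_fst:
  fixes F :: "'a::euclidean_space \<times> 'a \<Rightarrow> ennreal"
  assumes [measurable]: "F \<in> borel_measurable (borel \<Otimes>\<^sub>M borel)"
  shows "(\<integral>\<^sup>+x. \<integral>\<^sup>+y. F (x + t *\<^sub>R y, y) \<partial>lborel \<partial>lborel) = (\<integral>\<^sup>+x. \<integral>\<^sup>+y. F (x, y) \<partial>lborel \<partial>lborel)"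
proof -
  have "(\<integral>\<^sup>+x. \<integral>\<^sup>+y. F (x + t *\<^sub>R y, y) \<partial>lborel \<partial>lborel)
      = (\<integral>\<^sup>+y. \<integral>\<^sup>+x. F (x + t *\<^sub>R y, y) \<partial>lborel \<partial>lborel)"
    by (rule lborel_pair.Fubini') measurable
  also have "\<dots> = (\<integral>\<^sup>+y. \<integral>\<^sup>+x. F (x, y) \<partial>lborel \<partial>lborel)"
    by (intro nn_integral_cong nn_integral_lborel_shift) measurable
  also have "\<dots> = (\<integral>\<^sup>+x. \<integral>\<^sup>+y. F (x, y) \<partial>lborel \<partial>lborel)"
    by (rule lborel_pair.Fubini'[symmetric]) measurable
  finally show ?thesis .
qed

text \<open>A rotation by an angle other than \<open>\<pi>\<close> is a product of three shears, so that its invariance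
  follows from translation invariance and Fubini.\<close>
lemma nn_integral_lborel_rotation:
  fixes F :: "'a::euclidean_space \<times> 'a \<Rightarrow> ennreal"
  assumes [measurable]: "F \<in> borel_measurable (borel \<Otimes>\<^sub>M borel)"
    and ab: "a\<^sup>2 + b\<^sup>2 = 1" "a > -1"
  shows "(\<integral>\<^sup>+x. \<integral>\<^sup>+y. F (a *\<^sub>R x + b *\<^sub>R y, a *\<^sub>R y - b *\<^sub>R x) \<partial>lborel \<partial>lborel)
       = (\<integral>\<^sup>+x. \<integral>\<^sup>+y. F (x, y) \<partial>lborel \<partial>lborel)"
proof -
  \<comment> \<open>For \<open>a = cos s\<close>, \<open>b = sin s\<close> this is the tangent of
    \<open>s / 2\<close>. It is the coefficient of the two outer shears, the middle one having
    coefficient \<open>- b\<close>; the condition \<open>a > -1\<close> keeps the denominator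
    positive.\<close>
  define t where "t = b / (1 + a)"
  have t: "1 - b * t = a" "t * (1 + a) = b"
    using ab by (auto simp: t_def field_simps power2_eq_square)
  define G where "G = (\<lambda>(x, y). F (x + t *\<^sub>R y, y))"
  define K where "K = (\<lambda>(x, y). G (x, y + (-b) *\<^sub>R x))"
  have [measurable]: "G \<in> borel_measurable (borel \<Otimes>\<^sub>M borel)"
    unfolding G_def by measurable
  have [measurable]: "K \<in> borel_measurable (borel \<Otimes>\<^sub>M borel)"
    unfolding K_def by measurable
  have "K (x + t *\<^sub>R y, y) = F (a *\<^sub>R x + b *\<^sub>R y, a *\<^sub>R y - b *\<^sub>R x)" for x y
  proof -
    have "y + (-b) *\<^sub>R (x + t *\<^sub>R y) = (1 - b * t) *\<^sub>R y - b *\<^sub>R x"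
      by (simp add: algebra_simps)
    then have *: "y + (-b) *\<^sub>R (x + t *\<^sub>R y) = a *\<^sub>R y - b *\<^sub>R x"
      by (simp only: t)
    have "x + t *\<^sub>R y + t *\<^sub>R (a *\<^sub>R y - b *\<^sub>R x) = (1 - b * t) *\<^sub>R x + (t * (1 + a)) *\<^sub>R y"
      by (simp add: algebra_simps)
    then have "x + t *\<^sub>R y + t *\<^sub>R (a *\<^sub>R y - b *\<^sub>R x) = a *\<^sub>R x + b *\<^sub>R y"
      by (simp only: t)
    with * show ?thesis
      by (simp only: K_def G_def prod.case)
  qed
  then have "(\<integral>\<^sup>+x. \<integral>\<^sup>+y. F (a *\<^sub>R x + b *\<^sub>R y, a *\<^sub>R y - b *\<^sub>R x) \<partial>lborel \<partial>lborel)
      = (\<integral>\<^sup>+x. \<integral>\<^sup>+y. K (x + t *\<^sub>R y, y) \<partial>lborel \<partial>lborel)" by simp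
  also have "\<dots> = (\<integral>\<^sup>+x. \<integral>\<^sup>+y. K (x, y) \<partial>lborel \<partial>lborel)"
    by (rule nn_integral_lborel_shear_fst) measurable
  also have "\<dots> = (\<integral>\<^sup>+x. \<integral>\<^sup>+y. G (x, y + (-b) *\<^sub>R x) \<partial>lborel \<partial>lborel)"
    by (simp add: K_def)
  also have "\<dots> = (\<integral>\<^sup>+x. \<integral>\<^sup>+y. G (x, y) \<partial>lborel \<partial>lborel)"
    by (rule nn_integral_lborel_shear_snd) measurable
  also have "\<dots> = (\<integral>\<^sup>+x. \<integral>\<^sup>+y. F (x + t *\<^sub>R y, y) \<partial>lborel \<partial>lborel)"
    by (simp add: G_def)
  also have "\<dots> = (\<integral>\<^sup>+x. \<integral>\<^sup>+y. F (x, y) \<partial>lborel \<partial>lborel)"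
    by (rule nn_integral_lborel_shear_fst) measurable
  finally show ?thesis .
qed

section \<open>The standard Gaussian measure: product density, second moments, symmetries\<close>

lemma sets_mu2 [measurable_cong, simp]: "sets mu2 = sets borel"
  by (simp add: mu2_def)

lemma space_mu2 [simp]: "space mu2 = UNIV"
  by (simp add: mu2_def)

text \<open>Lets integrals of products over the coordinates factor into one-dimensional normal
  integrals through \<open>nn_integral_lborel_prod\<close>.\<close>

lemma gaussian_density_eq_prod:
  fixes y :: "'a::euclidean_space"
  shows "(2 * pi) powr (- real DIM('a) / 2) * exp (- (norm y)\<^sup>2 / 2)
       = (\<Prod>b\<in>Basis. std_normal_density (y \<bullet> b))"
proof -
  have "(\<Prod>b\<in>(Basis::'a set). 1 / sqrt (2 * pi)) = ((2 * pi) powr (- 1 / 2)) ^ DIM('a)"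
    by (simp add: powr_half_sqrt powr_minus_divide power_one_over)
  also have "\<dots> = (2 * pi) powr (- real DIM('a) / 2)"
    by (simp add: powr_power)
  finally have c: "(\<Prod>b\<in>(Basis::'a set). 1 / sqrt (2 * pi)) = (2 * pi) powr (- real DIM('a) / 2)" .
  have "(norm y)\<^sup>2 = (\<Sum>b\<in>Basis. (y \<bullet> b)\<^sup>2)"
    unfolding power2_norm_eq_inner by (subst euclidean_inner) (simp add: power2_eq_square)
  then have "exp (- (norm y)\<^sup>2 / 2) = (\<Prod>b\<in>Basis. exp (- (y \<bullet> b)\<^sup>2 / 2))"
    by (simp add: exp_sum[symmetric] sum_negf sum_divide_distrib)
  with c show ?thesis
    by (simp only: std_normal_density_def prod.distrib)
qed

lemma nn_integral_std_normal_density: "(\<integral>\<^sup>+x. ennreal (std_normal_density x) \<partial>lborel) = 1"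
  by (simp add: nn_integral_eq_integral)

lemma nn_integral_std_normal_second_moment:
  "(\<integral>\<^sup>+x. ennreal (std_normal_density x * x\<^sup>2) \<partial>lborel) = 1"
  using std_normal_moment_even[of 1]
  by (subst nn_integral_eq_integral) (auto simp: has_bochner_integral_iff)

lemma nn_integral_mu2:
  fixes f :: "'a::euclidean_space \<Rightarrow> ennreal"
  assumes [measurable]: "f \<in> borel_measurable borel"
  shows "(\<integral>\<^sup>+y. f y \<partial>mu2)
    = (\<integral>\<^sup>+y. ennreal ((2 * pi) powr (- real DIM('a) / 2) * exp (- (norm y)\<^sup>2 / 2)) * f y \<partial>lborel)"
  unfolding mu2_def by (subst nn_integral_density) measurable

lemma prob_space_mu2: "prob_space (mu2 :: 'a::euclidean_space measure)"
proof
  have "emeasure (mu2 :: 'a measure) (space mu2) = (\<integral>\<^sup>+y. 1 \<partial>(mu2 :: 'a measure))"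
    by simp
  also have "\<dots> = (\<integral>\<^sup>+y. (\<Prod>b\<in>Basis. ennreal (std_normal_density (y \<bullet> b))) \<partial>(lborel :: 'a measure))"
    by (subst nn_integral_mu2, simp, unfold gaussian_density_eq_prod) (simp add: prod_ennreal)
  also have "\<dots> = 1"
    by (subst nn_integral_lborel_prod) (simp_all add: nn_integral_std_normal_density)
  finally show "emeasure (mu2 :: 'a measure) (space mu2) = 1" .
qed

interpretation mu2: prob_space "mu2 :: 'a::euclidean_space measure"
  by (rule prob_space_mu2)

lemma nn_integral_mu2_coordinate_sq:
  fixes b :: "'a::euclidean_space"
  assumes b: "b \<in> Basis"
  shows "(\<integral>\<^sup>+y. ennreal ((y \<bullet> b)\<^sup>2) \<partial>mu2) = 1"
proof -
  \<comment> \<open>The square is absorbed into the factor of the coordinate \<open>b\<close> alone: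
    that factor integrates to the normal variance 1, every other one to the normal mass 1.\<close>
  define f where "f c t = ennreal (std_normal_density t * (if c = b then t\<^sup>2 else 1))" for c :: 'a and t
  have "(\<integral>\<^sup>+y. ennreal ((y \<bullet> b)\<^sup>2) \<partial>mu2) = (\<integral>\<^sup>+y. (\<Prod>c\<in>Basis. f c (y \<bullet> c)) \<partial>lborel)"
  proof (subst nn_integral_mu2)
    have "(\<Prod>c\<in>Basis. f c (y \<bullet> c))
        = ennreal ((\<Prod>c\<in>Basis. std_normal_density (y \<bullet> c)) * (y \<bullet> b)\<^sup>2)" for y
      unfolding f_def using b
      by (subst prod_ennreal) (auto simp: prod.distrib prod.delta)
    then show "(\<integral>\<^sup>+y. ennreal ((2 * pi) powr (- real DIM('a) / 2) * exp (- (norm y)\<^sup>2 / 2)) * ennreal ((y \<bullet> b)\<^sup>2) \<partial>lborel)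
      = (\<integral>\<^sup>+y. (\<Prod>c\<in>Basis. f c (y \<bullet> c)) \<partial>lborel)"
      unfolding gaussian_density_eq_prod by (simp add: ennreal_mult' prod_nonneg)
  qed simp
  also have "\<dots> = (\<Prod>c\<in>Basis. \<integral>\<^sup>+t. f c t \<partial>lborel)"
    by (rule nn_integral_lborel_prod) (auto simp: f_def)
  also have "\<dots> = 1"
  proof (intro prod.neutral ballI)
    show "(\<integral>\<^sup>+t. f c t \<partial>lborel) = 1" for c
      by (cases "c = b")
         (simp_all add: f_def nn_integral_std_normal_density nn_integral_std_normal_second_moment)
  qed
  finally show ?thesis .
qed

text \<open>Changing the sign of one coordinate is a diagonal map with entries 1 and -1, so its
  Jacobian factor is 1.\<close>

lemma nn_integral_lborel_reflect:
  fixes f :: "'a::euclidean_space \<Rightarrow> ennreal"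
  assumes [measurable]: "f \<in> borel_measurable borel" and b: "b \<in> Basis"
  shows "(\<integral>\<^sup>+y. f (y - (2 * (y \<bullet> b)) *\<^sub>R b) \<partial>lborel) = (\<integral>\<^sup>+y. f y \<partial>lborel)"
proof -
  define c :: "'a \<Rightarrow> real" where "c j = (if j = b then -1 else 1)" for j
  have T: "0 + (\<Sum>j\<in>Basis. (c j * (y \<bullet> j)) *\<^sub>R j) = y - (2 * (y \<bullet> b)) *\<^sub>R b" for y
  proof (rule euclidean_eqI)
    fix i :: 'a assume "i \<in> Basis"
    then show "(0 + (\<Sum>j\<in>Basis. (c j * (y \<bullet> j)) *\<^sub>R j)) \<bullet> i = (y - (2 * (y \<bullet> b)) *\<^sub>R b) \<bullet> i"
      using b by (cases "i = b") (simp_all add: c_def inner_diff_left inner_not_same_Basis)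
  qed
  have "density (distr lborel borel (\<lambda>y. 0 + (\<Sum>j\<in>Basis. (c j * (y \<bullet> j)) *\<^sub>R j)))
      (\<lambda>_. (\<Prod>j\<in>Basis. \<bar>c j\<bar>)) = lborel"
    by (rule lborel_affine_euclidean[symmetric]) (auto simp: c_def)
  moreover have "(\<Prod>j\<in>Basis. \<bar>c j\<bar>) = 1"
    by (intro prod.neutral) (auto simp: c_def)
  ultimately have "distr lborel borel (\<lambda>y. y - (2 * (y \<bullet> b)) *\<^sub>R b) = lborel"
    unfolding T by (simp add: density_1)
  then have "(\<integral>\<^sup>+y. f y \<partial>lborel) = (\<integral>\<^sup>+y. f y \<partial>distr lborel borel (\<lambda>y. y - (2 * (y \<bullet> b)) *\<^sub>R b))"
    by simp
  also have "\<dots> = (\<integral>\<^sup>+y. f (y - (2 * (y \<bullet> b)) *\<^sub>R b) \<partial>lborel)"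
    by (subst nn_integral_distr) auto
  finally show ?thesis by simp
qed

lemma nn_integral_mu2_reflect:
  fixes f :: "'a::euclidean_space \<Rightarrow> ennreal"
  assumes [measurable]: "f \<in> borel_measurable borel" and b: "b \<in> Basis"
  shows "(\<integral>\<^sup>+y. f (y - (2 * (y \<bullet> b)) *\<^sub>R b) \<partial>mu2) = (\<integral>\<^sup>+y. f y \<partial>mu2)"
proof -
  have norm: "(norm (y - (2 * (y \<bullet> b)) *\<^sub>R b))\<^sup>2 = (norm y)\<^sup>2" for y :: 'a
    using b unfolding power2_norm_eq_inner
    by (simp add: inner_diff_left inner_diff_right inner_commute)
  show ?thesis
    using nn_integral_lborel_reflect[OF _ b, of "\<lambda>y. ennreal ((2 * pi) powr (- real DIM('a) / 2) * exp (- (norm y)\<^sup>2 / 2)) * f y"]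
    by (simp add: nn_integral_mu2 norm)
qed

text \<open>Induction over the coordinates. Reflecting the new coordinate changes
  \<open>s + t\<close> into \<open>s - t\<close> without changing the integral; adding the two
  versions removes the cross term by a pointwise identity between nonnegative functions, so the
  cross term itself is never integrated.\<close>

lemma nn_integral_mu2_inner_sq:
  fixes v :: "'a::euclidean_space"
  shows "(\<integral>\<^sup>+y. ennreal ((v \<bullet> y)\<^sup>2) \<partial>mu2) = ennreal ((norm v)\<^sup>2)"
proof -
  have *: "(\<integral>\<^sup>+y. ennreal ((\<Sum>b\<in>S. (v \<bullet> b) * (y \<bullet> b))\<^sup>2) \<partial>(mu2 :: 'a measure)) = ennreal (\<Sum>b\<in>S. (v \<bullet> b)\<^sup>2)"
    if "finite S" "S \<subseteq> Basis" for S
    using that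
  proof (induction S rule: finite_induct)
    case empty
    then show ?case by simp
  next
    case (insert b S)
    then have b: "b \<in> Basis" and S: "S \<subseteq> Basis" by auto
    define s where "s y = (\<Sum>b\<in>S. (v \<bullet> b) * (y \<bullet> b))" for y
    define t where "t y = (v \<bullet> b) * (y \<bullet> b)" for y
    have [measurable]: "s \<in> borel_measurable borel" "t \<in> borel_measurable borel"
      unfolding s_def t_def by measurable
    have refl: "s (y - (2 * (y \<bullet> b)) *\<^sub>R b) = s y" "t (y - (2 * (y \<bullet> b)) *\<^sub>R b) = - t y" for y
      using b S insert.hyps
      by (auto simp: s_def t_def inner_diff_left inner_Basis algebra_simps intro!: sum.cong)
    let ?I = "\<integral>\<^sup>+y. ennreal ((s y + t y)\<^sup>2) \<partial>mu2"
    have "?I = (\<integral>\<^sup>+y. ennreal ((s y - t y)\<^sup>2) \<partial>mu2)"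
      using nn_integral_mu2_reflect[OF _ b, of "\<lambda>y. ennreal ((s y + t y)\<^sup>2)"] by (simp add: refl)
    then have "?I + ?I = (\<integral>\<^sup>+y. ennreal ((s y + t y)\<^sup>2) + ennreal ((s y - t y)\<^sup>2) \<partial>mu2)"
      by (subst nn_integral_add) simp_all
    also have "\<dots> = (\<integral>\<^sup>+y. ennreal (2 * (s y)\<^sup>2 + 2 * (t y)\<^sup>2) \<partial>mu2)"
      by (intro nn_integral_cong, subst ennreal_plus[symmetric], simp, simp, rule arg_cong[where f=ennreal])
         (simp add: power2_eq_square algebra_simps)
    also have "\<dots> = (\<integral>\<^sup>+y. 2 * ennreal ((s y)\<^sup>2) + ennreal (2 * (v \<bullet> b)\<^sup>2) * ennreal ((y \<bullet> b)\<^sup>2) \<partial>mu2)"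
      by (intro nn_integral_cong) (simp add: t_def ennreal_mult' power_mult_distrib mult.assoc)
    also have "\<dots> = 2 * ennreal (\<Sum>b\<in>S. (v \<bullet> b)\<^sup>2) + ennreal (2 * (v \<bullet> b)\<^sup>2)"
      using insert.IH[OF S]
      by (subst nn_integral_add)
         (simp_all add: nn_integral_cmult nn_integral_mu2_coordinate_sq[OF b] s_def)
    finally have "2 * ?I = 2 * ennreal (\<Sum>b\<in>insert b S. (v \<bullet> b)\<^sup>2)"
      using insert.hyps by (simp add: mult_2[symmetric] ennreal_mult' sum_nonneg distrib_left add.commute)
    then have "?I = ennreal (\<Sum>b\<in>insert b S. (v \<bullet> b)\<^sup>2)"
      by (subst (asm) ennreal_mult_cancel_left) auto
    then show ?case
      using insert.hyps by (simp add: s_def t_def add.commute)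
  qed
  have "(norm v)\<^sup>2 = (\<Sum>b\<in>Basis. (v \<bullet> b)\<^sup>2)"
    unfolding power2_norm_eq_inner by (subst euclidean_inner) (simp add: power2_eq_square)
  moreover have "(\<lambda>y. ennreal ((v \<bullet> y)\<^sup>2)) = (\<lambda>y. ennreal ((\<Sum>b\<in>Basis. (v \<bullet> b) * (y \<bullet> b))\<^sup>2))"
    by (rule ext) (subst euclidean_inner, rule refl)
  ultimately show ?thesis
    using *[of Basis] by simp
qed

text \<open>The joint density \<open>G\<close> of two independent Gaussian vectors depends only on
  the sum of their squared norms, which the rotation preserves; the rest is the invariance of
  Lebesgue measure.\<close>

lemma nn_integral_mu2_rotation:
  fixes F :: "'a::euclidean_space \<times> 'a \<Rightarrow> ennreal"
  assumes [measurable]: "F \<in> borel_measurable (borel \<Otimes>\<^sub>M borel)"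
    and ab: "a\<^sup>2 + b\<^sup>2 = 1" "a > -1"
  shows "(\<integral>\<^sup>+x. \<integral>\<^sup>+y. F (a *\<^sub>R x + b *\<^sub>R y, a *\<^sub>R y - b *\<^sub>R x) \<partial>mu2 \<partial>mu2)
       = (\<integral>\<^sup>+x. \<integral>\<^sup>+y. F (x, y) \<partial>mu2 \<partial>mu2)"
proof -
  let ?c = "(2 * pi) powr (- real DIM('a) / 2)"
  define G where "G = (\<lambda>(x::'a, y::'a). ennreal (?c * ?c * exp (- ((norm x)\<^sup>2 + (norm y)\<^sup>2) / 2)))"
  have [measurable]: "G \<in> borel_measurable (borel \<Otimes>\<^sub>M borel)"
    unfolding G_def by measurable
  have G_eq: "ennreal (?c * exp (- (norm x)\<^sup>2 / 2)) * ennreal (?c * exp (- (norm y)\<^sup>2 / 2)) = G (x, y)" for x y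
  proof -
    have "exp (- ((norm x)\<^sup>2 + (norm y)\<^sup>2) / 2) = exp (- (norm x)\<^sup>2 / 2) * exp (- (norm y)\<^sup>2 / 2)"
      by (simp add: exp_add[symmetric] field_simps)
    then show ?thesis
      unfolding G_def by (subst ennreal_mult'[symmetric]) (simp_all add: mult.assoc mult.left_commute)
  qed
  have norm: "(norm (a *\<^sub>R x + b *\<^sub>R y))\<^sup>2 + (norm (a *\<^sub>R y - b *\<^sub>R x))\<^sup>2 = (norm x)\<^sup>2 + (norm y)\<^sup>2" for x y :: 'a
  proof -
    have "(norm (a *\<^sub>R x + b *\<^sub>R y))\<^sup>2 + (norm (a *\<^sub>R y - b *\<^sub>R x))\<^sup>2 = (a\<^sup>2 + b\<^sup>2) * ((norm x)\<^sup>2 + (norm y)\<^sup>2)"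
      unfolding power2_norm_eq_inner
      by (simp add: inner_diff_left inner_diff_right inner_add_left inner_add_right inner_commute
          power2_eq_square algebra_simps)
    with ab show ?thesis by simp
  qed
  have dens: "(\<integral>\<^sup>+x. \<integral>\<^sup>+y. K (x, y) \<partial>mu2 \<partial>mu2) = (\<integral>\<^sup>+x. \<integral>\<^sup>+y. G (x, y) * K (x, y) \<partial>lborel \<partial>lborel)"
    if [measurable]: "K \<in> borel_measurable (borel \<Otimes>\<^sub>M borel)" for K :: "'a \<times> 'a \<Rightarrow> ennreal"
  proof -
    have "(\<integral>\<^sup>+x. \<integral>\<^sup>+y. K (x, y) \<partial>mu2 \<partial>mu2)
        = (\<integral>\<^sup>+x. ennreal (?c * exp (- (norm x)\<^sup>2 / 2)) * (\<integral>\<^sup>+y. K (x, y) \<partial>mu2) \<partial>lborel)"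
      by (rule nn_integral_mu2) measurable
    also have "\<dots> = (\<integral>\<^sup>+x. \<integral>\<^sup>+y. ennreal (?c * exp (- (norm x)\<^sup>2 / 2)) *
        (ennreal (?c * exp (- (norm y)\<^sup>2 / 2)) * K (x, y)) \<partial>lborel \<partial>lborel)"
      by (simp add: nn_integral_mu2 nn_integral_cmult)
    also have "\<dots> = (\<integral>\<^sup>+x. \<integral>\<^sup>+y. G (x, y) * K (x, y) \<partial>lborel \<partial>lborel)"
      by (simp only: mult.assoc[symmetric] G_eq)
    finally show ?thesis .
  qed
  define K where "K = (\<lambda>(x, y). F (a *\<^sub>R x + b *\<^sub>R y, a *\<^sub>R y - b *\<^sub>R x))"
  have [measurable]: "K \<in> borel_measurable (borel \<Otimes>\<^sub>M borel)"
    unfolding K_def by measurable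
  have "(\<integral>\<^sup>+x. \<integral>\<^sup>+y. K (x, y) \<partial>mu2 \<partial>mu2) = (\<integral>\<^sup>+x. \<integral>\<^sup>+y. G (x, y) * K (x, y) \<partial>lborel \<partial>lborel)"
    by (rule dens) measurable
  also have "\<dots> = (\<integral>\<^sup>+x. \<integral>\<^sup>+y. (\<lambda>p. G p * F p) (a *\<^sub>R x + b *\<^sub>R y, a *\<^sub>R y - b *\<^sub>R x) \<partial>lborel \<partial>lborel)"
    by (simp only: K_def G_def prod.case norm)
  also have "\<dots> = (\<integral>\<^sup>+x. \<integral>\<^sup>+y. (\<lambda>p. G p * F p) (x, y) \<partial>lborel \<partial>lborel)"
    by (rule nn_integral_lborel_rotation[OF _ ab]) measurable
  also have "\<dots> = (\<integral>\<^sup>+x. \<integral>\<^sup>+y. F (x, y) \<partial>mu2 \<partial>mu2)"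
    by (simp add: dens)
  finally show ?thesis by (simp add: K_def)
qed

section \<open>A two-point form of the Gaussian Poincare inequality\<close>

lemma increment_sq_le_nn_integral_deriv_sq:
  fixes \<phi> \<phi>' :: "real \<Rightarrow> real"
  assumes ab: "a < b"
    and deriv: "\<And>t. (\<phi> has_real_derivative \<phi>' t) (at t)"
    and cont: "continuous_on UNIV \<phi>'"
  shows "ennreal ((\<phi> b - \<phi> a)\<^sup>2) \<le> ennreal (b - a) * (\<integral>\<^sup>+t. indicator {a..b} t * ennreal ((\<phi>' t)\<^sup>2) \<partial>lborel)"
proof -
  \<comment> \<open>The mean slope. Expanding the nonnegative integral of
    \<open>(\<phi>' t - k)\<^sup>2\<close> gives the Cauchy-Schwarz bound
    \<open>(b - a) * k\<^sup>2 \<le> I\<close>.\<close>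
  define k where "k = (\<phi> b - \<phi> a) / (b - a)"
  have 1: "(\<phi>' has_integral (\<phi> b - \<phi> a)) {a..b}"
    using ab deriv
    by (intro fundamental_theorem_of_calculus)
       (auto simp: has_real_derivative_iff_has_vector_derivative[symmetric] intro: has_field_derivative_at_within)
  obtain I where I: "((\<lambda>t. (\<phi>' t)\<^sup>2) has_integral I) {a..b}"
    using integrable_continuous_interval[of a b "\<lambda>t. (\<phi>' t)\<^sup>2"] cont
    by (auto simp: integrable_on_def intro: continuous_intros continuous_on_subset)
  have "((\<lambda>t. (\<phi>' t)\<^sup>2 - 2 * k * \<phi>' t + k\<^sup>2) has_integral (I - 2 * k * (\<phi> b - \<phi> a) + (b - a) * k\<^sup>2)) {a..b}"
    using has_integral_const_real[of "k\<^sup>2" a b] ab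
    by (intro has_integral_add has_integral_diff has_integral_mult_right I 1) simp
  moreover have "(\<phi>' t)\<^sup>2 - 2 * k * \<phi>' t + k\<^sup>2 \<ge> 0" for t
    using zero_le_power2[of "\<phi>' t - k"] by (simp add: power2_eq_square algebra_simps)
  ultimately have "0 \<le> I - 2 * k * (\<phi> b - \<phi> a) + (b - a) * k\<^sup>2"
    by (rule has_integral_nonneg)
  moreover have "\<phi> b - \<phi> a = k * (b - a)"
    using ab by (simp add: k_def)
  ultimately have "(b - a) * k\<^sup>2 \<le> I"
    by (simp add: power2_eq_square algebra_simps)
  then have "(b - a) * ((b - a) * k\<^sup>2) \<le> (b - a) * I"
    using ab by (intro mult_left_mono) auto
  then have le: "(\<phi> b - \<phi> a)\<^sup>2 \<le> (b - a) * I"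
    using \<open>\<phi> b - \<phi> a = k * (b - a)\<close> by (simp add: power2_eq_square ac_simps)
  have "(\<integral>\<^sup>+t. indicator {a..b} t * ennreal ((\<phi>' t)\<^sup>2) \<partial>lborel) = ennreal I"
    using nn_integral_has_integral_lebesgue[OF _ I] cont
    by (simp add: nn_integral_completion borel_measurable_continuous_onI ennreal_mult' ennreal_indicator mult.commute)
  with le ab show ?thesis
    by (simp add: ennreal_mult'[symmetric] ennreal_leI)
qed

text \<open>At each time the position and the velocity on the arc are a rotation of
  \<open>(y, z)\<close>, hence again independent Gaussians, and averaging over the velocity leaves
  the squared norm of the gradient. One factor \<open>pi / 2\<close> comes from Cauchy-Schwarz in
  time, the other from integrating over the time interval.\<close>

lemma gaussian_poincare_pairs:
  fixes f :: "'a::euclidean_space \<Rightarrow> real"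
  assumes f: "smooth f"
  shows "(\<integral>\<^sup>+y. \<integral>\<^sup>+z. ennreal ((f y - f z)\<^sup>2) \<partial>mu2 \<partial>mu2)
    \<le> ennreal (pi\<^sup>2 / 4) * (\<integral>\<^sup>+y. ennreal (grad_sq f y) \<partial>mu2)"
proof -
  note [measurable] = smooth_borel_measurable[OF f] gradient_borel_measurable[OF f]
  interpret P: pair_sigma_finite lborel "mu2 :: 'a measure" ..
  define D where "D t y z = gradient f (cos t *\<^sub>R y + sin t *\<^sub>R z) \<bullet> (cos t *\<^sub>R z - sin t *\<^sub>R y)" for t y z
  have path: "ennreal ((f y - f z)\<^sup>2)
      \<le> ennreal (pi / 2) * (\<integral>\<^sup>+t. indicator {0..pi/2} t * ennreal ((D t y z)\<^sup>2) \<partial>lborel)" for y z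
  proof -
    have "((\<lambda>t. f (cos t *\<^sub>R y + sin t *\<^sub>R z)) has_real_derivative D t y z) (at t)" for t
    proof -
      have "((\<lambda>t. cos t *\<^sub>R y + sin t *\<^sub>R z) has_derivative (\<lambda>s. s *\<^sub>R (cos t *\<^sub>R z - sin t *\<^sub>R y))) (at t)"
        by (auto intro!: derivative_eq_intros simp: algebra_simps)
      from has_derivative_compose[OF this smooth_has_derivative[OF f]]
      show ?thesis
        by (auto simp: has_field_derivative_def D_def mult.commute[of _ "inner _ _"] elim!: has_derivative_eq_rhs)
    qed
    moreover have "continuous_on UNIV (\<lambda>t. D t y z)"
      unfolding D_def
      by (intro continuous_intros continuous_on_compose2[OF continuous_on_gradient[OF f, of UNIV]]) auto
    ultimately show ?thesis
      using increment_sq_le_nn_integral_deriv_sq[of 0 "pi/2" "\<lambda>t. f (cos t *\<^sub>R y + sin t *\<^sub>R z)" "\<lambda>t. D t y z"]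
      by (simp add: power2_commute)
  qed
  define E where "E = (\<lambda>(t, y, z). indicator {0..pi/2} t * ennreal ((D t y z)\<^sup>2))"
  have [measurable]: "E \<in> borel_measurable (borel \<Otimes>\<^sub>M borel \<Otimes>\<^sub>M borel)"
    unfolding E_def D_def by measurable
  let ?B = "\<integral>\<^sup>+y. ennreal (grad_sq f y) \<partial>mu2"
  have "(\<integral>\<^sup>+y. \<integral>\<^sup>+z. ennreal ((f y - f z)\<^sup>2) \<partial>mu2 \<partial>mu2)
      \<le> (\<integral>\<^sup>+y. \<integral>\<^sup>+z. ennreal (pi / 2) * (\<integral>\<^sup>+t. E (t, y, z) \<partial>lborel) \<partial>mu2 \<partial>mu2)"
    using path by (intro nn_integral_mono) (simp add: E_def)
  also have "\<dots> = ennreal (pi / 2) * (\<integral>\<^sup>+y. \<integral>\<^sup>+z. \<integral>\<^sup>+t. E (t, y, z) \<partial>lborel \<partial>mu2 \<partial>mu2)"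
    by (simp add: nn_integral_cmult)
  \<comment> \<open>Two applications of Fubini move the time integral outside, so that the rotation
    can be used at each fixed \<open>t\<close>.\<close>
  also have "(\<integral>\<^sup>+y. \<integral>\<^sup>+z. \<integral>\<^sup>+t. E (t, y, z) \<partial>lborel \<partial>mu2 \<partial>mu2) = (\<integral>\<^sup>+y. \<integral>\<^sup>+t. \<integral>\<^sup>+z. E (t, y, z) \<partial>mu2 \<partial>lborel \<partial>mu2)"
    by (intro nn_integral_cong P.Fubini') measurable
  also have "\<dots> = (\<integral>\<^sup>+t. \<integral>\<^sup>+y. \<integral>\<^sup>+z. E (t, y, z) \<partial>mu2 \<partial>mu2 \<partial>lborel)"
    by (intro P.Fubini') measurable
  also have "\<dots> = (\<integral>\<^sup>+t. ?B * indicator {0..pi/2} t \<partial>lborel)"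
  proof (intro nn_integral_cong)
    fix t :: real
    show "(\<integral>\<^sup>+y. \<integral>\<^sup>+z. E (t, y, z) \<partial>mu2 \<partial>mu2) = ?B * indicator {0..pi/2} t"
    proof (cases "t \<in> {0..pi/2}")
      case True
      \<comment> \<open>Only a quarter turn is used, so the cosine stays away from the value -1
        excluded in the rotation lemma.\<close>
      then have "cos t \<ge> 0" by (auto intro!: cos_ge_zero)
      then have "cos t > -1" by simp
      have "(\<integral>\<^sup>+y. \<integral>\<^sup>+z. E (t, y, z) \<partial>mu2 \<partial>mu2) = (\<integral>\<^sup>+y. \<integral>\<^sup>+z. (\<lambda>(y, z). ennreal ((gradient f y \<bullet> z)\<^sup>2))
          (cos t *\<^sub>R y + sin t *\<^sub>R z, cos t *\<^sub>R z - sin t *\<^sub>R y) \<partial>mu2 \<partial>mu2)"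
        using True by (simp add: E_def D_def)
      also have "\<dots> = (\<integral>\<^sup>+y. \<integral>\<^sup>+z. (\<lambda>(y, z). ennreal ((gradient f y \<bullet> z)\<^sup>2)) (y, z) \<partial>mu2 \<partial>mu2)"
        by (rule nn_integral_mu2_rotation) (auto simp: \<open>cos t > -1\<close>)
      also have "\<dots> = ?B"
        by (simp add: nn_integral_mu2_inner_sq grad_sq_eq_norm_gradient)
      finally show ?thesis using True by simp
    qed (simp add: E_def)
  qed
  also have "\<dots> = ?B * ennreal (pi / 2)"
    by (simp add: nn_integral_cmult)
  also have "ennreal (pi / 2) * (?B * ennreal (pi / 2)) = ennreal (pi\<^sup>2 / 4) * ?B"
  proof -
    have "ennreal (pi\<^sup>2 / 4) = ennreal (pi / 2) * ennreal (pi / 2)"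
      by (simp add: ennreal_mult'[symmetric] power2_eq_square)
    then show ?thesis by (simp only: ac_simps)
  qed
  finally show ?thesis .
qed

section \<open>Variance and averages\<close>

text \<open>If the bound failed at every point, multiplying by the positive weight and integrating
  would make the mass of \<open>w\<close> times \<open>R\<close> strictly smaller than itself. The
  conclusion gives an actual point although \<open>G\<close> may be infinite elsewhere.\<close>

lemma (in prob_space) exists_le_weighted_average:
  assumes [measurable]: "w \<in> borel_measurable M" "G \<in> borel_measurable M"
    and w: "\<And>y. 0 < w y" "\<And>y. w y < top"
    and fin: "(\<integral>\<^sup>+y. w y \<partial>M) < top"
    and R: "(\<integral>\<^sup>+y. w y * G y \<partial>M) \<le> R" "R < top"
  shows "\<exists>y. (\<integral>\<^sup>+y. w y \<partial>M) * G y \<le> R"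
proof (rule ccontr)
  let ?m = "\<integral>\<^sup>+y. w y \<partial>M"
  assume "\<nexists>y. ?m * G y \<le> R"
  then have "R < ?m * G y" for y by (simp add: not_le)
  then have less: "w y * R < w y * (?m * G y)" for y
    using w by (intro ennreal_mult_strict_left_mono) auto
  have "(\<integral>\<^sup>+y. w y * R \<partial>M) < (\<integral>\<^sup>+y. w y * (?m * G y) \<partial>M)"
  proof (rule nn_integral_less)
    \<comment> \<open>A strict pointwise inequality survives integration because the smaller
      integral is finite.\<close>
    show "(\<integral>\<^sup>+y. w y * R \<partial>M) \<noteq> \<infinity>"
      using fin R by (simp add: nn_integral_multc ennreal_mult_eq_top_iff less_top)
    show "\<not> (AE y in M. w y * (?m * G y) \<le> w y * R)"
      using less by (simp add: not_le[symmetric])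
  qed (use less in \<open>auto intro: less_imp_le\<close>)
  also have "\<dots> = ?m * (\<integral>\<^sup>+y. w y * G y \<partial>M)"
    by (simp add: mult.left_commute[of _ ?m] nn_integral_cmult)
  also have "\<dots> \<le> ?m * R"
    by (intro mult_left_mono R) simp
  finally show False
    by (simp add: nn_integral_multc)
qed

text \<open>The mean minimizes the squared deviation, so any constant \<open>c\<close> can certify a
  bound on the variance. This translates between \<open>Var\<close> and nonnegative integrals, and
  also covers the convention that \<open>Var\<close> is infinite without square
  integrability.\<close>

lemma (in prob_space) Var_le_iff_nn_integral:
  fixes g :: "'a \<Rightarrow> real"
  assumes [measurable]: "g \<in> borel_measurable M" and K: "K < top"
  shows "Var M g \<le> enn2ereal K \<longleftrightarrow> (\<exists>c. (\<integral>\<^sup>+x. ennreal ((g x - c)\<^sup>2) \<partial>M) \<le> K)"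
proof -
  obtain k where k: "K = ennreal k" "k \<ge> 0"
    using K by (cases K) auto
  have shift: "(\<integral>\<^sup>+x. ennreal ((g x - c)\<^sup>2) \<partial>M)
      = ennreal ((\<integral>x. (g x)\<^sup>2 \<partial>M) - 2 * c * (\<integral>x. g x \<partial>M) + c\<^sup>2)"
    if sq: "integrable M (\<lambda>x. (g x)\<^sup>2)" for c
  proof -
    have [simp]: "integrable M g"
      using square_integrable_imp_integrable[OF _ sq] by simp
    have e: "(g x - c)\<^sup>2 = (g x)\<^sup>2 - 2 * c * g x + c\<^sup>2" for x
      by (simp add: power2_eq_square algebra_simps)
    have "(\<integral>\<^sup>+x. ennreal ((g x - c)\<^sup>2) \<partial>M) = ennreal (\<integral>x. (g x - c)\<^sup>2 \<partial>M)"
    proof (intro nn_integral_eq_integral)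
      show "integrable M (\<lambda>x. (g x - c)\<^sup>2)"
        unfolding e using sq by simp
    qed simp
    also have "(\<integral>x. (g x - c)\<^sup>2 \<partial>M) = (\<integral>x. (g x)\<^sup>2 \<partial>M) - 2 * c * (\<integral>x. g x \<partial>M) + c\<^sup>2"
      unfolding e using sq by (simp add: prob_space)
    finally show ?thesis .
  qed
  show ?thesis
  proof
    assume "Var M g \<le> enn2ereal K"
    then have sq: "integrable M (\<lambda>x. (g x)\<^sup>2)"
      and le: "(\<integral>x. (g x)\<^sup>2 \<partial>M) - (\<integral>x. g x \<partial>M)\<^sup>2 \<le> k"
      using k by (auto simp: Var_def split: if_splits)
    have "(\<integral>\<^sup>+x. ennreal ((g x - (\<integral>x. g x \<partial>M))\<^sup>2) \<partial>M) \<le> K"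
      unfolding shift[OF sq] k(1) using le by (intro ennreal_leI) (simp add: power2_eq_square)
    then show "\<exists>c. (\<integral>\<^sup>+x. ennreal ((g x - c)\<^sup>2) \<partial>M) \<le> K" ..
  next
    assume "\<exists>c. (\<integral>\<^sup>+x. ennreal ((g x - c)\<^sup>2) \<partial>M) \<le> K"
    then obtain c where c: "(\<integral>\<^sup>+x. ennreal ((g x - c)\<^sup>2) \<partial>M) \<le> K" ..
    \<comment> \<open>A finite bound about one constant \<open>c\<close> already yields square
      integrability of \<open>g\<close>: on a probability space \<open>g - c\<close> is then
      integrable too, and the square of \<open>g\<close> is a combination of these
      functions.\<close>
    have "integrable M (\<lambda>x. (g x - c)\<^sup>2)"
      using c K by (intro integrableI_bounded) auto
    moreover from this have "integrable M (\<lambda>x. g x - c)"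
      by (rule square_integrable_imp_integrable[rotated]) simp
    ultimately have "integrable M (\<lambda>x. (g x - c)\<^sup>2 + 2 * c * (g x - c) + c\<^sup>2)"
      by auto
    also have "(\<lambda>x. (g x - c)\<^sup>2 + 2 * c * (g x - c) + c\<^sup>2) = (\<lambda>x. (g x)\<^sup>2)"
      by (auto simp: power2_eq_square algebra_simps)
    finally have sq: "integrable M (\<lambda>x. (g x)\<^sup>2)" .
    have "(\<integral>x. (g x)\<^sup>2 \<partial>M) - 2 * c * (\<integral>x. g x \<partial>M) + c\<^sup>2 \<le> k"
      using c k by (simp add: shift[OF sq] ennreal_le_iff)
    \<comment> \<open>This square is exactly the excess of the second moment about \<open>c\<close>
      over the variance.\<close>
    moreover have "0 \<le> ((\<integral>x. g x \<partial>M) - c)\<^sup>2"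
      by simp
    ultimately have "(\<integral>x. (g x)\<^sup>2 \<partial>M) - (\<integral>x. g x \<partial>M)\<^sup>2 \<le> k"
      unfolding power2_diff by (simp add: algebra_simps)
    then show "Var M g \<le> enn2ereal K"
      using sq k by (simp add: Var_def)
  qed
qed

section \<open>The product measure and the weighted inequality\<close>

lemma sets_mu1 [measurable_cong, simp]: "sets (mu1 U) = sets borel"
  by (simp add: mu1_def)

text \<open>A strictly positive integrand with zero integral would make the whole space a null set.
  This justifies dividing by the normalizing constant.\<close>

lemma integral_exp_pos:
  fixes U :: "'a::euclidean_space \<Rightarrow> real"
  assumes "integrable lborel (\<lambda>x. exp (- U x))"
  shows "0 < (\<integral>x. exp (- U x) \<partial>lborel)"
proof -
  have "(\<integral>x. exp (- U x) \<partial>lborel) \<noteq> 0"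
  proof
    assume "(\<integral>x. exp (- U x) \<partial>lborel) = 0"
    then have "AE x in lborel :: 'a measure. False"
      using assms by (subst (asm) integral_nonneg_eq_0_iff_AE) auto
    then show False
      using emeasure_lborel_UNIV by (subst (asm) AE_iff_measurable[of UNIV]) auto
  qed
  moreover have "0 \<le> (\<integral>x. exp (- U x) \<partial>lborel)"
    by simp
  ultimately show ?thesis by linarith
qed

lemma prob_space_mu1:
  assumes "integrable lborel (\<lambda>x. exp (- U x))"
  shows "prob_space (mu1 U)"
proof
  let ?Z = "\<integral>x. exp (- U x) \<partial>lborel"
  have "?Z > 0" by (rule integral_exp_pos[OF assms])
  have "(\<integral>\<^sup>+x. ennreal (exp (- U x) / ?Z) \<partial>lborel) = ennreal (\<integral>x. exp (- U x) / ?Z \<partial>lborel)"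
    using assms \<open>?Z > 0\<close> by (intro nn_integral_eq_integral) auto
  also have "\<dots> = 1"
    using \<open>?Z > 0\<close> by simp
  finally show "emeasure (mu1 U) (space (mu1 U)) = 1"
    using borel_measurable_integrable[OF assms]
    by (simp add: mu1_def emeasure_density)
qed

text \<open>Since \<open>H\<close> is a sum of functions of \<open>x\<close> and of
  \<open>y\<close>, Tonelli factors the normalizing constant as well as the exponential, and the
  density of \<open>mu U\<close> becomes the product of the two marginal densities.\<close>

lemma mu_eq_pair_measure:
  fixes U :: "'a::euclidean_space \<Rightarrow> real"
  assumes [measurable]: "U \<in> borel_measurable borel"
    and int: "integrable lborel (\<lambda>x. exp (- U x))"
  shows "mu U = mu1 U \<Otimes>\<^sub>M mu2"
proof -
  let ?Z = "\<integral>x. exp (- U x) \<partial>lborel" and ?c = "(2 * pi) powr (- real DIM('a) / 2)"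
  let ?G = "\<integral>\<^sup>+y. ennreal (exp (- (norm y)\<^sup>2 / 2)) \<partial>(lborel :: 'a measure)"
  have Z: "?Z > 0" by (rule integral_exp_pos[OF int])
  have c: "?c > 0" by simp
  \<comment> \<open>The Gaussian integral \<open>?G\<close> is read off from the fact that
    \<open>mu2\<close> has total mass 1.\<close>
  have "1 = (\<integral>\<^sup>+y. 1 \<partial>(mu2 :: 'a measure))"
    using mu2.emeasure_space_1 by simp
  also have "\<dots> = ennreal ?c * ?G"
    by (subst nn_integral_mu2) (simp_all add: ennreal_mult' nn_integral_cmult)
  finally have "ennreal (1 / ?c) * 1 = ennreal (1 / ?c) * (ennreal ?c * ?G)" by simp
  then have G: "?G = ennreal (1 / ?c)"
    using c by (simp add: mult.assoc[symmetric] ennreal_mult'[symmetric])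
  have H: "exp (- Hfun U (x, y)) = exp (- U x) * exp (- (norm y)\<^sup>2 / 2)" for x y
    by (simp add: Hfun_def mult_exp_exp)
  have [measurable]: "Hfun U \<in> borel_measurable (borel \<Otimes>\<^sub>M borel)"
    unfolding Hfun_def[abs_def] by measurable
  have "(\<integral>\<^sup>+q. ennreal (exp (- Hfun U q)) \<partial>lborel)
      = (\<integral>\<^sup>+x. \<integral>\<^sup>+y. ennreal (exp (- Hfun U (x, y))) \<partial>lborel \<partial>lborel)"
    unfolding lborel_prod[symmetric] by (rule lborel.nn_integral_fst[symmetric]) measurable
  also have "\<dots> = (\<integral>\<^sup>+x. ennreal (exp (- U x)) * ?G \<partial>lborel)"
    unfolding H by (simp add: ennreal_mult' nn_integral_cmult)
  also have "\<dots> = ennreal (?Z / ?c)"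
    using int Z c unfolding G
    by (simp add: nn_integral_multc nn_integral_eq_integral ennreal_mult'[symmetric])
  finally have "(\<integral>q. exp (- Hfun U q) \<partial>lborel) = ?Z / ?c"
    using Z c by (subst integral_eq_nn_integral) (auto simp: lborel_prod[symmetric])
  then have I: "exp (- Hfun U (x, y)) / (\<integral>q. exp (- Hfun U q) \<partial>lborel)
      = exp (- U x) / ?Z * (?c * exp (- (norm y)\<^sup>2 / 2))" for x y
    by (simp add: H)
  have "mu U = density (lborel \<Otimes>\<^sub>M lborel) (\<lambda>(x, y). ennreal (exp (- U x) / ?Z) * ennreal (?c * exp (- (norm y)\<^sup>2 / 2)))"
    unfolding mu_def lborel_prod
    by (intro arg_cong2[where f=density] refl ext)
       (use Z c in \<open>auto simp only: split_paired_all prod.case I ennreal_mult'' mult_nonneg_nonneg less_imp_le exp_gt_zero\<close>)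
  also have "\<dots> = mu1 U \<Otimes>\<^sub>M mu2"
    unfolding mu1_def mu2_def
    by (rule pair_measure_density[symmetric, OF _ _ lborel.sigma_finite_measure_axioms
          mu2.sigma_finite_measure_axioms[unfolded mu2_def]]) measurable
  finally show ?thesis .
qed

text \<open>The right side exceeds the left by one third of \<open>(r - 3 * s)\<^sup>2\<close>. The
  factor 4 on \<open>s\<close> matches the coefficient of \<open>C1\<close> in the claimed constant,
  and 4/3 is its conjugate.\<close>

lemma square_triangle_weighted: "(r + s)\<^sup>2 \<le> 4 / 3 * r\<^sup>2 + 4 * s\<^sup>2" for r s :: real
  using zero_le_power2[of "r - 3 * s"] by (simp add: power2_eq_square algebra_simps)

text \<open>A nonpositive power reverses the bound of \<open>H\<close> by a product. The resulting
  lower bound separates the variables: the \<open>y\<close>-factor is the averaging weight, the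
  \<open>x\<close>-factor the weight in the inequality for \<open>mu1\<close>.\<close>

lemma Hfun_powr_ge:
  assumes "U (fst p) \<ge> 1" "\<eta> \<ge> 0"
  shows "(1 + (norm (snd p))\<^sup>2 / 2) powr (- 2 * \<eta>) * U (fst p) powr (- 2 * \<eta>) \<le> Hfun U p powr (- 2 * \<eta>)"
proof -
  let ?s = "(norm (snd p))\<^sup>2 / 2"
  have "1 * ?s \<le> U (fst p) * ?s"
    using assms by (intro mult_right_mono) auto
  then have "Hfun U p \<le> (1 + ?s) * U (fst p)"
    by (simp add: Hfun_def algebra_simps)
  moreover have "0 < Hfun U p"
    using assms by (auto simp: Hfun_def intro: add_pos_nonneg)
  ultimately have "((1 + ?s) * U (fst p)) powr (- 2 * \<eta>) \<le> Hfun U p powr (- 2 * \<eta>)"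
    using assms by (intro powr_mono2') auto
  then show ?thesis
    using assms by (simp add: powr_mult)
qed

theorem theorem8:
  fixes U :: "'a::euclidean_space \<Rightarrow> real" and \<eta> C1 :: real
  assumes U_smooth: "smooth U"
    and U_ge1: "\<And>x. U x \<ge> 1"
    and U_int: "integrable lborel (\<lambda>x. exp (- U x))"
    and eta: "\<eta> \<ge> 0"
    and WP: "\<And>f :: 'a \<Rightarrow> real. smooth f \<Longrightarrow>
       Var (mu1 U) f \<le> ereal C1 *
         enn2ereal (\<integral>\<^sup>+ x. ennreal (U x powr (- 2 * \<eta>) * grad_sq f x) \<partial>mu1 U)"
  shows "\<exists>C'. C' \<le> max (2 + 4 / (\<integral>y. (1 + (norm y)\<^sup>2 / 2) powr (- 2 * \<eta>) \<partial>(mu2 :: 'a measure)))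
                          (4 * C1 / (\<integral>y. (1 + (norm y)\<^sup>2 / 2) powr (- 2 * \<eta>) \<partial>(mu2 :: 'a measure)))
     \<and> (\<forall>h :: 'a \<times> 'a \<Rightarrow> real. smooth h \<longrightarrow>
          Var (mu U) h \<le> ereal C' *
            enn2ereal (\<integral>\<^sup>+ p. ennreal (Hfun U p powr (- 2 * \<eta>) * grad_x_sq h p + grad_y_sq h p) \<partial>mu U))"
proof -
  note [measurable] = smooth_borel_measurable[OF U_smooth]
  interpret M1: prob_space "mu1 U"
    by (rule prob_space_mu1[OF U_int])
  interpret P: pair_prob_space "mu1 U" "mu2 :: 'a measure" ..
  have mu: "mu U = mu1 U \<Otimes>\<^sub>M mu2"
    by (rule mu_eq_pair_measure[OF _ U_int]) measurable
  define w :: "'a \<Rightarrow> real" where "w = (\<lambda>y. (1 + (norm y)\<^sup>2 / 2) powr (- 2 * \<eta>))"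
  have [measurable]: "w \<in> borel_measurable borel"
    unfolding w_def by measurable
  have base: "1 + (norm y)\<^sup>2 / 2 \<ge> 1" for y :: 'a by simp
  have w_pos: "0 < w y" for y
    using base[of y] unfolding w_def by (subst powr_gt_zero) linarith
  have w_le_1: "w y \<le> 1" for y
    using powr_mono2'[of "-2 * \<eta>" 1 "1 + (norm y)\<^sup>2 / 2"] base[of y] eta by (simp add: w_def)
  define m where "m = (\<integral>y. w y \<partial>mu2)"
  have w_int: "integrable mu2 w"
    by (rule mu2.integrable_const_bound[where B=1]) (auto simp: w_le_1 less_imp_le[OF w_pos])
  have m: "(\<integral>\<^sup>+y. ennreal (w y) \<partial>mu2) = ennreal m"
    unfolding m_def by (rule nn_integral_eq_integral[OF w_int]) (simp add: less_imp_le[OF w_pos])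
  have "m \<noteq> 0"
  proof
    assume "m = 0"
    then have "AE y in mu2 :: 'a measure. w y = 0"
      unfolding m_def using w_int
      by (subst (asm) integral_nonneg_eq_0_iff_AE) (auto simp: less_imp_le[OF w_pos])
    then show False
      using w_pos by (simp add: less_imp_neq[THEN not_sym])
  qed
  moreover have "m \<ge> 0"
    unfolding m_def by (simp add: less_imp_le[OF w_pos])
  ultimately have m_pos: "m > 0" by simp
  \<comment> \<open>Since the first entry of the maximum exceeds 4 / m, the constant C1 may be raised to at least 1;
    positivity then lets a bound on C * V z, below, show that V z is finite.\<close>
  define C where "C = max C1 1"
  \<comment> \<open>The claimed upper bound itself is the witness, chosen before \<open>h\<close>
    and so common to all \<open>h\<close>.\<close>
  define C' where "C' = max (2 + 4 / m) (4 * C1 / m)"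
  have C: "C \<ge> 1" "C1 \<le> C" by (auto simp: C_def)
  have "4 / m \<le> C'" "4 * C1 / m \<le> C'" by (auto simp: C'_def)
  then have C'_ge: "4 \<le> m * C'" "4 * C \<le> m * C'"
    using m_pos by (auto simp: C_def field_simps max_def)
  then have "m * C' > 0" by simp
  then have C'_pos: "C' > 0" using m_pos by (simp add: zero_less_mult_iff)
  have "Var (mu U) h \<le> ereal C' *
      enn2ereal (\<integral>\<^sup>+ p. ennreal (Hfun U p powr (- 2 * \<eta>) * grad_x_sq h p + grad_y_sq h p) \<partial>mu U)"
    (is "_ \<le> _ * enn2ereal ?I")
    if h: "smooth h" for h :: "'a \<times> 'a \<Rightarrow> real"
  proof (cases "?I = top")
    case True
    then show ?thesis using C'_pos by simp
  next
    case False
    have [measurable]: "h \<in> borel_measurable (borel \<Otimes>\<^sub>M borel)"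
      "grad_x_sq h \<in> borel_measurable (borel \<Otimes>\<^sub>M borel)"
      "grad_y_sq h \<in> borel_measurable (borel \<Otimes>\<^sub>M borel)"
      unfolding borel_prod using h
      by (auto intro: smooth_borel_measurable grad_x_sq_borel_measurable grad_y_sq_borel_measurable)
    have [measurable]: "Hfun U \<in> borel_measurable (borel \<Otimes>\<^sub>M borel)"
      unfolding Hfun_def[abs_def] by measurable
    have nonneg [simp]: "0 \<le> grad_x_sq h p" "0 \<le> grad_y_sq h p" for p
      by (auto simp: grad_x_sq_def grad_y_sq_def intro: sum_nonneg)
    define A where "A = (\<integral>\<^sup>+p. ennreal (Hfun U p powr (- 2 * \<eta>) * grad_x_sq h p) \<partial>(mu1 U \<Otimes>\<^sub>M mu2))"
    define B where "B = (\<integral>\<^sup>+p. ennreal (grad_y_sq h p) \<partial>(mu1 U \<Otimes>\<^sub>M mu2))"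
    have I: "?I = A + B"
      unfolding mu A_def B_def by (subst nn_integral_add[symmetric]) (auto simp: ennreal_plus)
    with False have fin: "A < top" "B < top" by (auto simp: less_top)

    \<comment> \<open>\<open>S z\<close> is the cost of replacing \<open>h (x, y)\<close> by
      \<open>h (x, z)\<close>, and \<open>V z\<close> is the weighted energy of the slice at
      \<open>z\<close>. Either may be infinite for some \<open>z\<close>; only their weighted
      averages are controlled.\<close>
    define S where "S z = (\<integral>\<^sup>+x. \<integral>\<^sup>+y. ennreal ((h (x, y) - h (x, z))\<^sup>2) \<partial>mu2 \<partial>mu1 U)" for z
    define V where "V z = (\<integral>\<^sup>+x. ennreal (U x powr (- 2 * \<eta>) * grad_x_sq h (x, z)) \<partial>mu1 U)" for z
    have [measurable]: "S \<in> borel_measurable borel" "V \<in> borel_measurable borel"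
      unfolding S_def V_def by measurable
    have S_le: "(\<integral>\<^sup>+z. ennreal (w z) * S z \<partial>mu2) \<le> ennreal (pi\<^sup>2 / 4) * B"
    proof -
      have "(\<integral>\<^sup>+z. ennreal (w z) * S z \<partial>mu2) \<le> (\<integral>\<^sup>+z. 1 * S z \<partial>mu2)"
        by (intro nn_integral_mono mult_right_mono) (auto simp: w_le_1)
      also have "\<dots> = (\<integral>\<^sup>+x. \<integral>\<^sup>+z. \<integral>\<^sup>+y. ennreal ((h (x, y) - h (x, z))\<^sup>2) \<partial>mu2 \<partial>mu2 \<partial>mu1 U)"
        unfolding S_def mult_1 by (intro P.Fubini') measurable
      \<comment> \<open>The squared difference is symmetric, which puts the points in the order of
        the pair inequality for the slice at \<open>x\<close>.\<close>
      also have "\<dots> = (\<integral>\<^sup>+x. \<integral>\<^sup>+z. \<integral>\<^sup>+y. ennreal ((h (x, z) - h (x, y))\<^sup>2) \<partial>mu2 \<partial>mu2 \<partial>mu1 U)"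
        by (simp add: power2_commute)
      also have "\<dots> \<le> (\<integral>\<^sup>+x. ennreal (pi\<^sup>2 / 4) * (\<integral>\<^sup>+y. ennreal (grad_y_sq h (x, y)) \<partial>mu2) \<partial>mu1 U)"
        using gaussian_poincare_pairs[OF smooth_slice_snd[OF h]]
        by (intro nn_integral_mono) (simp add: grad_sq_slice_snd[OF h])
      also have "\<dots> = ennreal (pi\<^sup>2 / 4) * B"
        unfolding B_def by (simp add: nn_integral_cmult mu2.nn_integral_fst[symmetric])
      finally show ?thesis .
    qed
    have V_le: "(\<integral>\<^sup>+z. ennreal (w z) * V z \<partial>mu2) \<le> A"
    proof -
      have "(\<integral>\<^sup>+z. ennreal (w z) * V z \<partial>mu2)
          = (\<integral>\<^sup>+z. \<integral>\<^sup>+x. ennreal (w z * U x powr (- 2 * \<eta>) * grad_x_sq h (x, z)) \<partial>mu1 U \<partial>mu2)"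
        unfolding V_def
        by (subst nn_integral_cmult[symmetric])
           (auto simp: ennreal_mult'[symmetric] less_imp_le[OF w_pos] mult.assoc)
      also have "\<dots> \<le> (\<integral>\<^sup>+z. \<integral>\<^sup>+x. ennreal (Hfun U (x, z) powr (- 2 * \<eta>) * grad_x_sq h (x, z)) \<partial>mu1 U \<partial>mu2)"
        using Hfun_powr_ge[OF U_ge1 eta]
        by (intro nn_integral_mono ennreal_leI mult_right_mono) (auto simp: w_def)
      also have "\<dots> = A"
        unfolding A_def by (rule P.nn_integral_snd) measurable
      finally show ?thesis .
    qed
    define G where "G z = ennreal (4 / 3) * S z + ennreal (4 * C) * V z" for z
    have [measurable]: "G \<in> borel_measurable borel"
      unfolding G_def by measurable
    \<comment> \<open>A rational bound on \<open>pi\<close> is enough: the square of 16/5 is below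
      12.\<close>
    have "pi\<^sup>2 \<le> (16 / 5)\<^sup>2"
      using pi_approx(2) by (intro power_mono) auto
    then have pi_le: "4 / 3 * (pi\<^sup>2 / 4) \<le> 4"
      by (simp add: power2_eq_square)
    have "(\<integral>\<^sup>+z. ennreal (w z) * G z \<partial>mu2)
        = (\<integral>\<^sup>+z. ennreal (4 / 3) * (ennreal (w z) * S z) + ennreal (4 * C) * (ennreal (w z) * V z) \<partial>mu2)"
      by (intro nn_integral_cong) (simp only: G_def distrib_left mult.left_commute)
    also have "\<dots> = ennreal (4 / 3) * (\<integral>\<^sup>+z. ennreal (w z) * S z \<partial>mu2)
        + ennreal (4 * C) * (\<integral>\<^sup>+z. ennreal (w z) * V z \<partial>mu2)"
      by (subst nn_integral_add) (simp_all add: nn_integral_cmult)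
    also have "\<dots> \<le> ennreal (4 / 3) * (ennreal (pi\<^sup>2 / 4) * B) + ennreal (4 * C) * A"
      by (intro add_mono mult_left_mono S_le V_le) auto
    also have "ennreal (4 / 3) * (ennreal (pi\<^sup>2 / 4) * B) = ennreal (4 / 3 * (pi\<^sup>2 / 4)) * B"
      by (subst ennreal_mult') (simp_all add: mult.assoc)
    also have "ennreal (4 / 3 * (pi\<^sup>2 / 4)) * B + ennreal (4 * C) * A \<le> ennreal (m * C') * B + ennreal (m * C') * A"
      using pi_le C'_ge by (intro add_mono mult_right_mono ennreal_leI zero_le) linarith+
    also have "\<dots> = ennreal (m * C') * (A + B)"
      by (simp only: distrib_left add.commute)
    finally have "(\<integral>\<^sup>+z. ennreal (w z) * G z \<partial>mu2) \<le> ennreal (m * C') * (A + B)" .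
    \<comment> \<open>The weight has mass \<open>m\<close>, the same factor that multiplies
      \<open>C'\<close> on the right, so it cancels once a good slice \<open>z\<close> is
      chosen.\<close>
    then have "\<exists>z. (\<integral>\<^sup>+z. ennreal (w z) \<partial>mu2) * G z \<le> ennreal (m * C') * (A + B)"
      using fin w_pos
      by (intro mu2.exists_le_weighted_average) (auto simp: m ennreal_mult_less_top)
    then obtain z where "ennreal m * G z \<le> ennreal m * (ennreal C' * (A + B))"
      using m_pos C'_pos by (auto simp: m ennreal_mult' mult.assoc)
    then have Gz: "G z \<le> ennreal C' * (A + B)"
      using m_pos by (subst (asm) ennreal_mult_le_mult_iff) auto
    also have "\<dots> < top"
      using fin by (simp add: ennreal_mult_less_top)
    finally have "G z < top" .
    then have V_fin: "V z < top"
      using C by (auto simp: G_def ennreal_mult_less_top)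
    have hz: "smooth (\<lambda>x. h (x, z))"
      by (rule smooth_slice_fst[OF h])
    have "Var (mu1 U) (\<lambda>x. h (x, z)) \<le> ereal C1 * enn2ereal (V z)"
      using WP[OF hz] by (simp add: V_def grad_sq_slice_fst[OF h])
    \<comment> \<open>\<open>C1\<close> may be negative, so the product stays in
      \<open>ereal\<close> until \<open>C1\<close> is replaced by \<open>C\<close>; only then can it
      be moved to \<open>ennreal\<close>.\<close>
    also have "\<dots> \<le> ereal C * enn2ereal (V z)"
      using C by (intro ereal_mult_right_mono) auto
    also have "\<dots> = enn2ereal (ennreal C * V z)"
      using C by (simp add: times_ennreal.rep_eq)
    finally obtain c where c: "(\<integral>\<^sup>+x. ennreal ((h (x, z) - c)\<^sup>2) \<partial>mu1 U) \<le> ennreal C * V z"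
      using V_fin by (subst (asm) M1.Var_le_iff_nn_integral) (auto simp: ennreal_mult_less_top)
    have "(\<integral>\<^sup>+p. ennreal ((h p - c)\<^sup>2) \<partial>mu U) = (\<integral>\<^sup>+x. \<integral>\<^sup>+y. ennreal ((h (x, y) - c)\<^sup>2) \<partial>mu2 \<partial>mu1 U)"
      unfolding mu by (rule mu2.nn_integral_fst[symmetric]) measurable
    also have "\<dots> \<le> (\<integral>\<^sup>+x. \<integral>\<^sup>+y. ennreal (4 / 3) * ennreal ((h (x, y) - h (x, z))\<^sup>2)
        + ennreal 4 * ennreal ((h (x, z) - c)\<^sup>2) \<partial>mu2 \<partial>mu1 U)"
    proof (intro nn_integral_mono)
      fix x y
      have "(h (x, y) - c)\<^sup>2 \<le> 4 / 3 * (h (x, y) - h (x, z))\<^sup>2 + 4 * (h (x, z) - c)\<^sup>2"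
        using square_triangle_weighted[of "h (x, y) - h (x, z)" "h (x, z) - c"] by simp
      then have "ennreal ((h (x, y) - c)\<^sup>2) \<le> ennreal (4 / 3 * (h (x, y) - h (x, z))\<^sup>2 + 4 * (h (x, z) - c)\<^sup>2)"
        by (rule ennreal_leI)
      also have "\<dots> = ennreal (4 / 3) * ennreal ((h (x, y) - h (x, z))\<^sup>2) + ennreal 4 * ennreal ((h (x, z) - c)\<^sup>2)"
        by (subst (1 2) ennreal_mult'[symmetric]) (simp_all add: ennreal_plus)
      finally show "ennreal ((h (x, y) - c)\<^sup>2) \<le> ennreal (4 / 3) * ennreal ((h (x, y) - h (x, z))\<^sup>2) + ennreal 4 * ennreal ((h (x, z) - c)\<^sup>2)" .
    qed
    \<comment> \<open>The second summand does not depend on \<open>y\<close>, and \<open>mu2\<close>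
      has mass 1.\<close>
    also have "\<dots> = ennreal (4 / 3) * S z + ennreal 4 * (\<integral>\<^sup>+x. ennreal ((h (x, z) - c)\<^sup>2) \<partial>mu1 U)"
      unfolding S_def
      by (simp add: nn_integral_add nn_integral_cmult mu2.emeasure_space_1[simplified])
    also have "\<dots> \<le> ennreal (4 / 3) * S z + ennreal 4 * (ennreal C * V z)"
      by (intro add_mono mult_left_mono c) auto
    also have "\<dots> = G z"
      using C by (simp add: G_def ennreal_mult' mult.assoc)
    also note Gz
    finally have "(\<integral>\<^sup>+p. ennreal ((h p - c)\<^sup>2) \<partial>mu U) \<le> ennreal C' * (A + B)" .
    moreover have "ennreal C' * (A + B) < top"
      using fin by (simp add: ennreal_mult_less_top)
    \<comment> \<open>The constant \<open>c\<close> comes from the slice at \<open>z\<close> and may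
      differ from the mean of \<open>h\<close>; a bound about any constant suffices here.\<close>
    ultimately have "Var (mu U) h \<le> enn2ereal (ennreal C' * (A + B))"
      unfolding mu by (subst P.Var_le_iff_nn_integral) auto
    also have "\<dots> = ereal C' * enn2ereal ?I"
      unfolding I using C'_pos by (simp add: times_ennreal.rep_eq)
    finally show ?thesis .
  qed
  then show ?thesis
    unfolding C'_def m_def w_def by (intro exI[of _ C'] conjI) (auto simp: C'_def m_def w_def)
qed

end
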